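(* Let $G$ be an undirected, connected, loop-free multigraph on $n\ge 2$ vertices, of genus $g\ge 1$ and stretch factor $\kappa$. Let $\lambda\in[1/g,g]$. The covering radius of $\mathrm{Crit}_{\triangle}(L_G)$ with respect to $P_{1,\lambda}$ is at least $$\frac{1}{n}\sqrt{\frac{g}{\kappa\lambda}}.$$
   Context: For a connected, loop-free multigraph $G=(V,E)$ with $n$ vertices and $m$ edges, the genus is $g=m-n+1$, and the stretch factor is $\kappa=\max\{\lceil n(n-1)/m\rceil,1\}$. The Laplacian lattice $L_G$ is the image of $\mathbb{Z}^n$ under the Laplacian matrix of $G$; it is a full rank lattice in $H_0$, where for $d\in\mathbb{R}$, $H_d=\{x\in\mathbb{R}^n:\sum_i x_i=d\}$. $\triangle\subset H_0$ is the convex hull of $\mathbf{b}_1,\dots,\mathbf{b}_n$, $\mathbf{b}_i=(n-1)\mathbf{e}_i-\sum_{j\ne i}\mathbf{e}_j$, and $\bar\triangle=-\triangle$. $P_{1,\lambda}=\triangle+\lambda\bar\triangle$ (Minkowski sum). For a convex body $C\subset H_0$ containing the origin, $d_C(\mathbf{p}_1,\mathbf{p}_2)=\min\{\mu\ge 0:\mathbf{p}_2\in\mathbf{p}_1+\mu C\}$. For a discrete $T\subset H_0$ invariant under translation by a full rank lattice of $H_0$ with finitely many orbits, $h_{C,T}(\mathbf{p})=\min_{\mu\in T}d_C(\mathbf{p},\mu)$ for $\mathbf{p}\in H_0$, and the covering radius of $T$ with respect to $C$ is the maximum of $h_{C,T}$ on $H_0$. $\mathrm{Crit}_{\triangle}(L_G)$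 is the set of local maxima of $h_{\triangle,L_G}$ on $H_0$. *)

theory Defs
  imports "HOL-Analysis.Analysis" "HOL-Library.Multiset" "HOL-Library.Set_Algebras"
begin

text \<open>
  An undirected loop-free multigraph on the vertex set \<open>UNIV :: 'v set\<close> (so \<open>n = CARD('v)\<close>) is
  given by its multiset of edges, each edge being the two-element set of its end points;
  parallel edges are repeated elements.
\<close>

definition loop_free_multigraph :: "'v set multiset \<Rightarrow> bool" where
  "loop_free_multigraph E \<longleftrightarrow> (\<forall>e \<in># E. card e = 2)"

definition connected_multigraph :: "'v set multiset \<Rightarrow> bool" where
  "connected_multigraph E \<longleftrightarrow> (\<forall>u v. (u, v) \<in> {(x, y). {x, y} \<in># E}\<^sup>*)"

definition genus :: "'v::finite set multiset \<Rightarrow> int" where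
  "genus E = int (size E) - int CARD('v) + 1"

definition stretch_factor :: "'v::finite set multiset \<Rightarrow> int" where
  "stretch_factor E = max \<lceil>real CARD('v) * (real CARD('v) - 1) / real (size E)\<rceil> 1"

definition vertex_degree :: "'v set multiset \<Rightarrow> 'v \<Rightarrow> nat" where
  "vertex_degree E v = size {#e \<in># E. v \<in> e#}"

definition laplacian :: "'v::finite set multiset \<Rightarrow> real ^ 'v ^ 'v" where
  "laplacian E = (\<chi> i j. if i = j then real (vertex_degree E i) else - real (count E {i, j}))"

definition laplacian_lattice :: "'v::finite set multiset \<Rightarrow> (real ^ 'v) set" where
  "laplacian_lattice E = (\<lambda>z. laplacian E *v z) ` {z. \<forall>i. z $ i \<in> \<int>}"

definition hyperplane :: "real \<Rightarrow> (real ^ 'v::finite) set" where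
  "hyperplane d = {x. (\<Sum>i\<in>UNIV. x $ i) = d}"

definition simplex_vertex :: "'v::finite \<Rightarrow> real ^ 'v" where
  "simplex_vertex i =
     (real CARD('v) - 1) *\<^sub>R axis i 1 - (\<Sum>j \<in> UNIV - {i}. axis j 1)"

definition std_triangle :: "(real ^ 'v::finite) set" where
  "std_triangle = convex hull (range simplex_vertex)"

text \<open>Here \<open>+\<close> on sets is the Minkowski sum.\<close>

definition P1 :: "real \<Rightarrow> (real ^ 'v::finite) set" where
  "P1 l = std_triangle + (*\<^sub>R) l ` (uminus ` std_triangle)"

text \<open>
  The minima and the maximum in the next three definitions are rendered by \<open>Inf\<close> and \<open>Sup\<close> of
  sets of reals. They are attained when \<open>C\<close> is a compact convex subset of \<open>hyperplane 0\<close>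
  containing the origin in its relative interior, the points lie in \<open>hyperplane 0\<close>, and \<open>T\<close> is a
  nonempty discrete subset of \<open>hyperplane 0\<close> consisting of finitely many orbits of a full rank
  lattice.
\<close>

definition convex_dist :: "(real ^ 'v::finite) set \<Rightarrow> real ^ 'v \<Rightarrow> real ^ 'v \<Rightarrow> real" where
  "convex_dist C p q = Inf {\<mu>. 0 \<le> \<mu> \<and> q \<in> (+) p ` ((*\<^sub>R) \<mu> ` C)}"

definition dist_to_set :: "(real ^ 'v::finite) set \<Rightarrow> (real ^ 'v) set \<Rightarrow> real ^ 'v \<Rightarrow> real" where
  "dist_to_set C T p = (INF t\<in>T. convex_dist C p t)"

definition covering_radius :: "(real ^ 'v::finite) set \<Rightarrow> (real ^ 'v) set \<Rightarrow> real" where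
  "covering_radius C T = (SUP p\<in>hyperplane 0. dist_to_set C T p)"

definition Crit :: "(real ^ 'v::finite) set \<Rightarrow> (real ^ 'v) set \<Rightarrow> (real ^ 'v) set" where
  "Crit C T = {c \<in> hyperplane 0. \<exists>\<epsilon>>0. \<forall>x \<in> hyperplane 0.
     dist x c < \<epsilon> \<longrightarrow> dist_to_set C T x \<le> dist_to_set C T c}"

end

theory Submission
  imports Defs
begin

text \<open>
  Write \<open>n\<close> for the number of vertices, \<open>m\<close> for the number of edges, \<open>L\<close> for the Laplacian and
  \<open>h\<close> for the distance to the Laplacian lattice with respect to the simplex. The simplex consists
  of the points of \<open>hyperplane 0\<close> whose coordinates are all at least \<open>- 1\<close>, so \<open>h p\<close> is the
  infimum over lattice points \<open>l\<close> of the largest coordinate of \<open>p - l\<close>.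

  The critical points are exactly the points \<open>m / n - L z - indeg\<close>, where \<open>z\<close> is an
  integer vector and \<open>indeg\<close> is the vector of indegrees of an acyclic orientation (\<open>Crit_eq\<close>).
  Acyclic orientations are encoded by injective rankings of the vertices, every edge pointing to
  its end point of larger rank. The description rests on a real version of Dhar's burning
  algorithm (\<open>le_indeg_if_not_above\<close>): a vector that does not strictly dominate any lattice point
  is dominated by some \<open>L z + indeg\<close>. Conversely the vectors of indegrees and of outdegrees do
  not strictly dominate any lattice point (\<open>indeg_not_above\<close>, \<open>outdeg_not_above\<close>).

  Two points of \<open>hyperplane 0\<close> are far from all critical points. For the origin, every
  critical point \<open>c\<close> has a coordinate that is at least \<open>m / n\<close>, since \<open>- L z\<close> exceeds or equals
  \<open>indeg\<close> somewhere. For the point \<open>p = 2 m / n - deg\<close>, the mirror image of the origin under the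
  symmetry that reverses orientations, \<open>c - p\<close> has a coordinate that is at most \<open>- m / n\<close>.
  The coordinates of the points of \<open>P1 l\<close> lie between \<open>- (1 + l (n - 1))\<close> and \<open>n - 1 + l\<close>.
  Hence the covering radius is at least \<open>m / (n (n - 1 + l))\<close> and at least
  \<open>m / (n (1 + l (n - 1)))\<close>. The first bound suffices for \<open>l \<ge> 1\<close> and the second one for
  \<open>l \<le> 1\<close> (\<open>sqrt_genus_bound\<close>): after squaring, the inequality is convex in \<open>l\<close>, so that only
  \<open>l = 1\<close> and \<open>l = g\<close> have to be examined, and it is here that the stretch factor enters.

  Since the covering radius is a supremum of reals, it also has to be shown that the distances are
  bounded. The real Laplacian maps onto \<open>hyperplane 0\<close>, and rounding a preimage to an integer vector
  changes its image by at most the vertex degrees (\<open>lap_approx\<close>), which gives a critical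
  point at bounded distance from every point.
\<close>

section \<open>The simplex and the distances it defines\<close>

lemma one_le_card_real: "1 \<le> real CARD('v::finite)"
  using zero_less_card_finite[where 'a = 'v] by linarith

lemma simplex_vertex_component:
  "simplex_vertex i $ j = (if j = i then real CARD('v) - 1 else - 1)" for i j :: "'v::finite"
  by (simp add: simplex_vertex_def axis_def sum.If_cases)

lemma std_triangle_eq:
  "std_triangle = {x \<in> hyperplane 0. \<forall>i::'v::finite. - 1 \<le> x $ i}"
proof (intro equalityI subsetI)
  let ?C = "{x \<in> hyperplane 0. \<forall>i::'v. - 1 \<le> x $ i}"
  have "convex ?C"
  proof (rule convexI)
    fix x y :: "real^'v" and a b :: real
    assume *: "x \<in> ?C" "y \<in> ?C" "0 \<le> a" "0 \<le> b" "a + b = 1"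
    have "a * - 1 + b * - 1 \<le> a * x $ i + b * y $ i" for i
      using * by (intro add_mono mult_left_mono) auto
    with * show "a *\<^sub>R x + b *\<^sub>R y \<in> ?C"
      by (simp add: hyperplane_def sum.distrib sum_distrib_left[symmetric])
        (metis add_uminus_conv_diff minus_add_distrib)
  qed
  moreover have "range simplex_vertex \<subseteq> ?C"
    using one_le_card_real[where 'v = 'v]
    by (auto simp: hyperplane_def simplex_vertex_component sum.If_cases card_Diff_subset
        Compl_eq_Diff_UNIV of_nat_diff Suc_le_eq)
  ultimately have "convex hull (range simplex_vertex) \<subseteq> ?C" by (simp add: hull_minimal)
  then show "x \<in> ?C" if "x \<in> std_triangle" for x
    using that by (auto simp: std_triangle_def)
next
  fix x assume "x \<in> {x \<in> hyperplane 0. \<forall>i::'v. - 1 \<le> x $ i}"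
  then have s: "(\<Sum>i\<in>UNIV. x $ i) = 0" and ge: "\<And>i. - 1 \<le> x $ i"
    by (auto simp: hyperplane_def)
  define n where "n = real CARD('v)"
  have n: "n > 0" by (simp add: n_def)
  define u where "u i = (x $ i + 1) / n" for i
  have u1: "(\<Sum>i\<in>UNIV. u i) = 1"
    using s n by (simp add: u_def sum_divide_distrib[symmetric] sum.distrib n_def)
  have "(\<Sum>i\<in>UNIV. u i *\<^sub>R simplex_vertex i) \<in> std_triangle"
    unfolding std_triangle_def
  proof (intro convex_sum)
    show "0 \<le> u i" for i
      using ge[of i] n by (simp add: u_def)
  qed (use u1 in \<open>auto simp: hull_inc\<close>)
  moreover have "(\<Sum>i\<in>UNIV. u i *\<^sub>R simplex_vertex i) = x"
  proof -
    have "(\<Sum>i\<in>UNIV. u i * simplex_vertex i $ j) = x $ j" for j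
    proof -
      have "(\<Sum>i\<in>UNIV. u i * simplex_vertex i $ j) = (\<Sum>i\<in>UNIV. (if j = i then u i * n else 0) - u i)"
        by (intro sum.cong) (auto simp: simplex_vertex_component n_def algebra_simps)
      also have "\<dots> = u j * n - 1" by (simp add: sum_subtractf u1)
      also have "\<dots> = x $ j" using n by (simp add: u_def)
      finally show ?thesis .
    qed
    then show ?thesis by (simp add: vec_eq_iff)
  qed
  ultimately show "x \<in> std_triangle" by simp
qed

text \<open>No sign condition on \<open>\<mu>\<close> is needed on the right: the coordinates of \<open>p - q\<close> add up to 0.\<close>

lemma in_scaled_std_triangle_iff:
  assumes p: "p \<in> hyperplane 0" and q: "q \<in> hyperplane 0"
  shows "0 \<le> \<mu> \<and> q \<in> (+) p ` ((*\<^sub>R) \<mu> ` std_triangle) \<longleftrightarrow> (\<forall>i::'v::finite. p $ i - q $ i \<le> \<mu>)"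
proof
  assume "0 \<le> \<mu> \<and> q \<in> (+) p ` ((*\<^sub>R) \<mu> ` std_triangle)"
  then obtain x where x: "0 \<le> \<mu>" "q = p + \<mu> *\<^sub>R x" "\<And>i. - 1 \<le> x $ i"
    by (auto simp: std_triangle_eq)
  have "\<mu> * - 1 \<le> \<mu> * x $ i" for i using x by (intro mult_left_mono) auto
  then show "\<forall>i. p $ i - q $ i \<le> \<mu>" using x(2) by (auto simp: minus_le_iff)
next
  assume le: "\<forall>i. p $ i - q $ i \<le> \<mu>"
  have sum0: "(\<Sum>i\<in>UNIV. p $ i - q $ i) = 0"
    using p q by (simp add: hyperplane_def sum_subtractf)
  have "(\<Sum>i\<in>UNIV. p $ i - q $ i) \<le> (\<Sum>i\<in>(UNIV::'v set). \<mu>)"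
    using le by (intro sum_mono) auto
  then have mu: "0 \<le> \<mu>" using sum0 by (simp add: zero_le_mult_iff)
  show "0 \<le> \<mu> \<and> q \<in> (+) p ` ((*\<^sub>R) \<mu> ` std_triangle)"
  proof (cases "\<mu> = 0")
    case True
    have "(\<Sum>i\<in>UNIV. q $ i - p $ i) = 0"
      using p q by (simp add: hyperplane_def sum_subtractf)
    then have "\<forall>i\<in>UNIV. q $ i - p $ i = 0"
      using le True by (subst (asm) sum_nonneg_eq_0_iff) auto
    then have "q = p" by (simp add: vec_eq_iff)
    moreover have "0 \<in> (std_triangle :: (real^'v) set)"
      by (simp add: std_triangle_eq hyperplane_def)
    ultimately show ?thesis using True by force
  next
    case False
    have "(1 / \<mu>) *\<^sub>R (q - p) \<in> std_triangle"
      using False mu le p q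
      by (auto simp: std_triangle_eq hyperplane_def sum_divide_distrib[symmetric] sum_subtractf
          field_simps)
    then have "(*\<^sub>R) \<mu> ((1 / \<mu>) *\<^sub>R (q - p)) \<in> (*\<^sub>R) \<mu> ` std_triangle" by (rule imageI)
    then have "q - p \<in> (*\<^sub>R) \<mu> ` std_triangle" using False by simp
    then have "p + (q - p) \<in> (+) p ` ((*\<^sub>R) \<mu> ` std_triangle)" by (rule imageI)
    then show ?thesis using mu by simp
  qed
qed

lemma convex_dist_std_triangle:
  assumes "p \<in> hyperplane 0" "q \<in> hyperplane 0"
  shows "convex_dist std_triangle p q = (MAX i::'v::finite. p $ i - q $ i)"
proof -
  have "convex_dist std_triangle p q = Inf {\<mu>. \<forall>i. p $ i - q $ i \<le> \<mu>}"
    unfolding convex_dist_def in_scaled_std_triangle_iff[OF assms] ..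
  also have "{\<mu>. \<forall>i. p $ i - q $ i \<le> \<mu>} = {(MAX i. p $ i - q $ i)..}"
    by auto
  finally show ?thesis by (simp add: cInf_atLeast)
qed

lemma convex_dist_le:
  assumes C: "std_triangle \<subseteq> C" and pq: "p \<in> hyperplane 0" "q \<in> hyperplane 0"
    and le: "\<And>i::'v::finite. p $ i - q $ i \<le> \<mu>"
  shows "convex_dist C p q \<le> \<mu>"
  unfolding convex_dist_def
proof (rule cInf_lower)
  show "\<mu> \<in> {\<mu>. 0 \<le> \<mu> \<and> q \<in> (+) p ` ((*\<^sub>R) \<mu> ` C)}"
    using in_scaled_std_triangle_iff[OF pq, of \<mu>] le C by blast
  show "bdd_below {\<mu>. 0 \<le> \<mu> \<and> q \<in> (+) p ` ((*\<^sub>R) \<mu> ` C)}"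
    by (rule bdd_belowI[of _ 0]) auto
qed

lemma le_convex_distI:
  assumes C: "std_triangle \<subseteq> C" and pq: "p \<in> hyperplane 0" "q \<in> hyperplane (0::real)"
    and le: "\<And>\<mu> x. 0 \<le> \<mu> \<Longrightarrow> x \<in> C \<Longrightarrow> q = p + \<mu> *\<^sub>R x \<Longrightarrow> a \<le> \<mu>"
  shows "a \<le> convex_dist C p (q::real^'v::finite)"
  unfolding convex_dist_def
proof (rule cInf_greatest)
  have "\<forall>i. p $ i - q $ i \<le> (MAX i. p $ i - q $ i)" by auto
  then show "{\<mu>. 0 \<le> \<mu> \<and> q \<in> (+) p ` ((*\<^sub>R) \<mu> ` C)} \<noteq> {}"
    using in_scaled_std_triangle_iff[OF pq, of "MAX i. p $ i - q $ i"] C by blast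
  fix \<mu> assume "\<mu> \<in> {\<mu>. 0 \<le> \<mu> \<and> q \<in> (+) p ` ((*\<^sub>R) \<mu> ` C)}"
  then show "a \<le> \<mu>" using le by auto
qed

lemma convex_dist_nonneg:
  assumes "p \<in> hyperplane 0" "q \<in> hyperplane 0"
  shows "0 \<le> convex_dist std_triangle p q"
  using assms by (intro le_convex_distI) auto

text \<open>
  The assumption \<open>near\<close> bounds the distances to \<open>T\<close> from above; without it the supremum in the
  definition of the covering radius would be unspecified.
\<close>

lemma covering_radius_geI:
  fixes T :: "(real^'v::finite) set"
  assumes T: "T \<subseteq> hyperplane 0" and C: "std_triangle \<subseteq> C"
    and near: "\<And>p. p \<in> hyperplane 0 \<Longrightarrow> \<exists>t\<in>T. \<forall>i. p $ i - t $ i \<le> B"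
    and p: "p \<in> hyperplane 0"
    and far: "\<And>t x \<mu>. t \<in> T \<Longrightarrow> 0 \<le> \<mu> \<Longrightarrow> x \<in> C \<Longrightarrow> t = p + \<mu> *\<^sub>R x \<Longrightarrow> a \<le> \<mu>"
  shows "a \<le> covering_radius C T"
proof -
  have nonneg: "0 \<le> convex_dist C q t" if "q \<in> hyperplane 0" "t \<in> T" for q t
    using that T C by (intro le_convex_distI) auto
  have "dist_to_set C T q \<le> B" if q: "q \<in> hyperplane 0" for q
  proof -
    obtain t where t: "t \<in> T" "\<And>i. q $ i - t $ i \<le> B" using near[OF q] by blast
    have "dist_to_set C T q \<le> convex_dist C q t"
      unfolding dist_to_set_def using nonneg[OF q]
      by (intro cINF_lower t bdd_belowI2[of _ 0])
    also have "\<dots> \<le> B" using t T q C by (intro convex_dist_le) auto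
    finally show ?thesis .
  qed
  then have "bdd_above (dist_to_set C T ` hyperplane 0)" by (intro bdd_aboveI2)
  then have "dist_to_set C T p \<le> covering_radius C T"
    unfolding covering_radius_def using p by (intro cSUP_upper)
  moreover have "a \<le> dist_to_set C T p"
    unfolding dist_to_set_def
    using near[OF p] far T C p by (intro cINF_greatest le_convex_distI) auto
  ultimately show ?thesis by linarith
qed

lemma std_triangle_subset_P1: "std_triangle \<subseteq> (P1 l :: (real^'v::finite) set)"
proof
  fix x :: "real^'v" assume x: "x \<in> std_triangle"
  have "0 \<in> (std_triangle :: (real^'v) set)" by (simp add: std_triangle_eq hyperplane_def)
  then have "0 \<in> (*\<^sub>R) l ` uminus ` (std_triangle :: (real^'v) set)" by force
  with x have "x + 0 \<in> P1 l" unfolding P1_def by (rule set_plus_intro)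
  then show "x \<in> P1 l" by simp
qed

lemma std_triangle_le:
  fixes x :: "real^'v::finite"
  assumes "x \<in> std_triangle"
  shows "x $ i \<le> real CARD('v) - 1"
proof -
  have "0 = x $ i + (\<Sum>j\<in>UNIV - {i}. x $ j)"
    using assms by (simp add: std_triangle_eq hyperplane_def sum.remove[of UNIV i])
  moreover have "(\<Sum>j\<in>UNIV - {i}. - 1) \<le> (\<Sum>j\<in>UNIV - {i}. x $ j)"
    using assms by (intro sum_mono) (auto simp: std_triangle_eq)
  moreover have "real (card (UNIV - {i})) = real CARD('v) - 1"
    using one_le_card_real[where 'v = 'v] by (simp add: card_Diff_subset of_nat_diff Suc_le_eq)
  ultimately show ?thesis by simp
qed

lemma P1_bounds:
  fixes x :: "real^'v::finite"
  assumes "0 \<le> l" "x \<in> P1 l"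
  shows "x $ i \<le> real CARD('v) - 1 + l" "- x $ i \<le> 1 + l * (real CARD('v) - 1)"
proof -
  obtain y z where yz: "y \<in> std_triangle" "z \<in> std_triangle" and x: "x = y - l *\<^sub>R z"
    using assms(2) by (auto simp: P1_def elim!: set_plus_elim)
  have "l * - 1 \<le> l * z $ i" "l * z $ i \<le> l * (real CARD('v) - 1)"
    using assms(1) yz std_triangle_le[OF yz(2), of i]
    by (intro mult_left_mono; auto simp: std_triangle_eq)+
  moreover have "- 1 \<le> y $ i" "y $ i \<le> real CARD('v) - 1"
    using yz std_triangle_le by (auto simp: std_triangle_eq)
  ultimately show "x $ i \<le> real CARD('v) - 1 + l" "- x $ i \<le> 1 + l * (real CARD('v) - 1)"
    by (simp_all add: x)
qed

section \<open>The Laplacian of a weighted graph\<close>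

text \<open>
  A connected loop-free multigraph, given by the number \<open>w u v\<close> of edges between \<open>u\<close> and \<open>v\<close>.
\<close>

locale connected_weights =
  fixes w :: "'v::finite \<Rightarrow> 'v \<Rightarrow> nat"
  assumes w_sym: "w u v = w v u"
    and w_irrefl: "w v v = 0"
    and w_connected: "(u, v) \<in> {(x, y). 0 < w x y}\<^sup>*"
begin

text \<open>The Laplacian, acting on real functions on the vertices.\<close>

definition lap :: "('v \<Rightarrow> real) \<Rightarrow> 'v \<Rightarrow> real" where
  "lap z v = (\<Sum>u\<in>UNIV. real (w v u) * (z v - z u))"

text \<open>
  Indegree and outdegree in the acyclic orientation in which every edge points to its end point
  of larger rank. They describe an acyclic orientation of the whole graph only when \<open>r\<close> is
  injective, since edges between vertices of equal rank are ignored.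
\<close>

definition indeg :: "('v \<Rightarrow> nat) \<Rightarrow> 'v \<Rightarrow> real" where
  "indeg r v = (\<Sum>u | r u < r v. real (w v u))"

definition outdeg :: "('v \<Rightarrow> nat) \<Rightarrow> 'v \<Rightarrow> real" where
  "outdeg r v = (\<Sum>u | r v < r u. real (w v u))"

definition deg :: "'v \<Rightarrow> real" where
  "deg v = (\<Sum>u\<in>UNIV. real (w v u))"

text \<open>The number of edges.\<close>

definition mass :: real where
  "mass = (\<Sum>v\<in>UNIV. deg v) / 2"

lemma deg_nonneg: "0 \<le> deg v"
  by (simp add: deg_def sum_nonneg)

lemma indeg_plus_outdeg:
  assumes "inj r"
  shows "indeg r v + outdeg r v = deg v"
proof -
  have "deg v = (\<Sum>u\<in>{u. r u < r v} \<union> ({u. r v < r u} \<union> {v}). real (w v u))"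
    unfolding deg_def using injD[OF assms] by (intro sum.cong) (auto, metis linorder_less_linear)
  also have "\<dots> = indeg r v + (outdeg r v + real (w v v))"
    unfolding indeg_def outdeg_def
    by (subst sum.union_disjoint, auto simp: w_irrefl)
  finally show ?thesis by (simp add: w_irrefl)
qed

lemma sum_indeg:
  assumes "inj r"
  shows "(\<Sum>v\<in>UNIV. indeg r v) = mass"
proof -
  have "(\<Sum>v\<in>UNIV. indeg r v) = (\<Sum>v\<in>UNIV. \<Sum>u\<in>UNIV. if r u < r v then real (w v u) else 0)"
    by (simp add: indeg_def sum.If_cases)
  also have "\<dots> = (\<Sum>u\<in>UNIV. \<Sum>v\<in>UNIV. if r u < r v then real (w v u) else 0)"
    by (rule sum.swap)
  also have "\<dots> = (\<Sum>v\<in>UNIV. outdeg r v)"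
    by (simp add: outdeg_def sum.If_cases w_sym)
  finally have "(\<Sum>v\<in>UNIV. indeg r v) = (\<Sum>v\<in>UNIV. outdeg r v)" .
  moreover have "(\<Sum>v\<in>UNIV. indeg r v) + (\<Sum>v\<in>UNIV. outdeg r v) = (\<Sum>v\<in>UNIV. deg v)"
    by (simp add: sum.distrib[symmetric] indeg_plus_outdeg[OF assms])
  ultimately show ?thesis by (simp add: mass_def)
qed

text \<open>
  The Laplacian of \<open>z\<close> is the divergence of the flow \<open>z v - z u\<close> along the edges, so its sum over
  \<open>S\<close> is the net flow out of \<open>S\<close>.
\<close>

lemma sum_lap:
  "(\<Sum>v\<in>S. lap z v) = (\<Sum>v\<in>S. \<Sum>u\<in>-S. real (w v u) * (z v - z u))"
proof -
  let ?f = "\<lambda>v u. real (w v u) * (z v - z u)"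
  have "(\<Sum>v\<in>S. \<Sum>u\<in>S. ?f v u) = (\<Sum>u\<in>S. \<Sum>v\<in>S. ?f v u)"
    by (rule sum.swap)
  also have "\<dots> = (\<Sum>u\<in>S. \<Sum>v\<in>S. - ?f u v)"
    by (intro sum.cong refl) (simp add: w_sym algebra_simps)
  also have "\<dots> = - (\<Sum>v\<in>S. \<Sum>u\<in>S. ?f v u)"
    by (simp add: sum_negf)
  finally have 0: "(\<Sum>v\<in>S. \<Sum>u\<in>S. ?f v u) = 0" by simp
  have "lap z v = (\<Sum>u\<in>S. ?f v u) + (\<Sum>u\<in>-S. ?f v u)" for v
    unfolding lap_def by (subst sum.union_disjoint[symmetric]) auto
  with 0 show ?thesis by (simp add: sum.distrib)
qed

lemma sum_lap_UNIV: "(\<Sum>v\<in>UNIV. lap z v) = 0"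
  by (subst sum_lap) simp

lemma lap_add: "lap (\<lambda>v. y v + z v) v = lap y v + lap z v"
  by (simp add: lap_def sum.distrib[symmetric] algebra_simps)

lemma lap_diff: "lap (\<lambda>v. y v - z v) v = lap y v - lap z v"
  by (simp add: lap_def sum_subtractf[symmetric] algebra_simps)

lemma lap_scale: "lap (\<lambda>v. c * z v) v = c * lap z v"
  by (simp add: lap_def sum_distrib_left algebra_simps)

lemma lap_eq_0_imp_const:
  assumes "\<And>v. lap z v = 0"
  shows "z a = z b"
proof -
  \<comment> \<open>Maximum principle: the set on which \<open>z\<close> is maximal is closed under adjacency.\<close>
  define M where "M = Max (range z)"
  have le: "z v \<le> M" for v by (simp add: M_def)
  have "M \<in> range z" unfolding M_def by (rule Max_in) auto
  then obtain v0 where v0: "z v0 = M" by auto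
  have "z v = M" if "(v0, v) \<in> {(x, y). 0 < w x y}\<^sup>*" for v
    using that
  proof (induction rule: rtrancl_induct)
    case (step x y)
    have "\<forall>u\<in>UNIV. real (w x u) * (z x - z u) = 0"
      using assms[of x] step.IH le unfolding lap_def
      by (subst (asm) sum_nonneg_eq_0_iff) auto
    then have "real (w x y) * (z x - z y) = 0" by blast
    with step show ?case by simp
  qed (rule v0)
  with w_connected show ?thesis by simp
qed

lemma lap_surj:
  assumes "(\<Sum>v\<in>UNIV. y v) = 0"
  shows "\<exists>z. \<forall>v. lap z v = y v"
proof -
  \<comment> \<open>Adding the sum of the coordinates removes the kernel, which consists of the constants.\<close>
  define T :: "real^'v \<Rightarrow> real^'v"
    where "T z = (\<chi> v. lap (($) z) v + (\<Sum>u\<in>UNIV. z $ u))" for z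
  have lin: "linear T"
  proof (rule linearI)
    fix x y :: "real^'v" and c :: real
    have "($) (x + y) = (\<lambda>v. x $ v + y $ v)" "($) (c *\<^sub>R x) = (\<lambda>v. c * x $ v)"
      by (simp_all add: fun_eq_iff)
    then show "T (x + y) = T x + T y" "T (c *\<^sub>R x) = c *\<^sub>R T x"
      by (simp_all add: T_def vec_eq_iff lap_add lap_scale sum.distrib sum_distrib_left[symmetric]
        algebra_simps)
  qed
  have sumT: "(\<Sum>v\<in>UNIV. T z $ v) = real CARD('v) * (\<Sum>u\<in>UNIV. z $ u)" for z
    by (simp add: T_def sum.distrib sum_lap_UNIV)
  have "z = 0" if "T z = 0" for z
  proof -
    have s0: "(\<Sum>u\<in>UNIV. z $ u) = 0" using sumT[of z] that by simp
    have "lap (($) z) v = 0" for v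
      using that s0 by (simp add: T_def vec_eq_iff)
    then have c: "z $ a = z $ b" for a b by (rule lap_eq_0_imp_const)
    have "real CARD('v) * z $ a = 0" for a
    proof -
      have "(\<Sum>u\<in>UNIV. z $ u) = (\<Sum>u\<in>(UNIV :: 'v set). z $ a)"
        by (rule sum.cong[OF refl c])
      with s0 show ?thesis by simp
    qed
    then show ?thesis by (simp add: vec_eq_iff)
  qed
  then have "inj T" using lin by (simp add: linear_injective_0)
  then have "surj T" by (rule linear_inj_imp_surj[OF lin])
  then obtain z where z: "T z = (\<chi> v. y v)" by (metis surjD)
  have "(\<Sum>u\<in>UNIV. z $ u) = 0" using sumT[of z] assms by (simp add: z)
  then have "lap (($) z) v = y v" for v
    using z by (simp add: T_def vec_eq_iff)
  then show ?thesis by blast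
qed

text \<open>The image of the integer vectors under the Laplacian is relatively dense in \<open>hyperplane 0\<close>.\<close>

lemma lap_approx:
  assumes "(\<Sum>v\<in>UNIV. y v) = 0"
  shows "\<exists>z::'v \<Rightarrow> int. \<forall>v. \<bar>y v - lap (\<lambda>v. of_int (z v)) v\<bar> \<le> deg v"
proof -
  obtain z where z: "\<And>v. lap z v = y v" using lap_surj[OF assms] by blast
  have "\<bar>y v - lap (\<lambda>v. of_int \<lfloor>z v\<rfloor>) v\<bar> \<le> deg v" for v
  proof -
    have "y v - lap (\<lambda>v. of_int \<lfloor>z v\<rfloor>) v = lap (\<lambda>v. frac (z v)) v"
      by (simp add: frac_def lap_diff z)
    also have "\<bar>\<dots>\<bar> \<le> (\<Sum>u\<in>UNIV. \<bar>real (w v u) * (frac (z v) - frac (z u))\<bar>)"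
      unfolding lap_def by (rule sum_abs)
    also have "\<dots> \<le> (\<Sum>u\<in>UNIV. real (w v u) * 1)"
    proof (rule sum_mono)
      fix u
      have "\<bar>frac (z v) - frac (z u)\<bar> \<le> 1"
        using frac_ge_0[of "z v"] frac_ge_0[of "z u"] frac_lt_1[of "z v"] frac_lt_1[of "z u"]
        by linarith
      then show "\<bar>real (w v u) * (frac (z v) - frac (z u))\<bar> \<le> real (w v u) * 1"
        unfolding abs_mult by (intro mult_mono) auto
    qed
    finally show ?thesis by (simp add: deg_def)
  qed
  then show ?thesis by (intro exI[of _ "\<lambda>v. \<lfloor>z v\<rfloor>"]) auto
qed

text \<open>
  The bound on \<open>z v\<close> is uniform in \<open>z\<close>. It spreads from \<open>q\<close> along edges: if \<open>a\<close> and \<open>b\<close> are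
  adjacent and \<open>z b > max 0 (z a)\<close>, then the net flow out of the superlevel set of \<open>b\<close>, which
  contains neither \<open>a\<close> nor \<open>q\<close>, is at least \<open>z b - z a\<close> and at most the sum of the \<open>\<bar>x u\<bar>\<close>.
\<close>

lemma subsolution_bounded:
  "\<exists>B. \<forall>z. z q = 0 \<longrightarrow> (\<forall>u. u \<noteq> q \<longrightarrow> lap z u \<le> x u) \<longrightarrow> z v \<le> B"
proof -
  define M where "M = (\<Sum>u\<in>UNIV. \<bar>x u\<bar>)"
  have M0: "0 \<le> M" unfolding M_def by (rule sum_nonneg) simp
  have "(q, v) \<in> {(x, y). 0 < w x y}\<^sup>*" by (rule w_connected)
  then show ?thesis
  proof (induction rule: rtrancl_induct)
    case base
    show ?case by (rule exI[of _ 0]) simp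
  next
    case (step a b)
    then obtain B where
      B: "\<And>z. z q = 0 \<Longrightarrow> (\<And>u. u \<noteq> q \<Longrightarrow> lap z u \<le> x u) \<Longrightarrow> z a \<le> B" by blast
    have "z b \<le> max 0 (B + M)" if q: "z q = 0" and sub: "\<And>u. u \<noteq> q \<Longrightarrow> lap z u \<le> x u" for z
    proof (cases "z b \<le> 0 \<or> z b \<le> z a")
      case True
      then show ?thesis using B[OF q sub] M0 by linarith
    next
      case False
      define S where "S = {u. z b \<le> z u}"
      have nn: "0 \<le> real (w v u) * (z v - z u)" if "v \<in> S" "u \<in> -S" for u v
        using that by (auto simp: S_def)
      have ab: "a \<in> -S" "b \<in> S" "q \<notin> S" using False q by (auto simp: S_def)
      have "z b - z a \<le> real (w b a) * (z b - z a)"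
        using step(2) w_sym[of a b] False by (intro mult_le_cancel_right1[THEN iffD2]) auto
      also have "\<dots> \<le> (\<Sum>u\<in>-S. real (w b u) * (z b - z u))"
        using nn ab by (intro member_le_sum) auto
      also have "\<dots> \<le> (\<Sum>v\<in>S. \<Sum>u\<in>-S. real (w v u) * (z v - z u))"
        using nn ab by (intro member_le_sum[of b S "\<lambda>v. \<Sum>u\<in>-S. real (w v u) * (z v - z u)"])
          (auto intro!: sum_nonneg)
      also have "\<dots> = (\<Sum>v\<in>S. lap z v)" by (rule sum_lap[symmetric])
      also have "\<dots> \<le> (\<Sum>v\<in>S. \<bar>x v\<bar>)"
        using sub ab(3) by (intro sum_mono) (metis abs_ge_self order_trans)
      also have "\<dots> \<le> M" unfolding M_def by (intro sum_mono2) auto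
      finally show ?thesis using B[OF q sub] by linarith
    qed
    then show ?case by blast
  qed
qed

section \<open>Burning and acyclic orientations\<close>

lemma lap_indicator:
  "lap (\<lambda>u. if u \<in> A then 0 else 1) v =
     (if v \<in> A then - (\<Sum>u\<in>-A. real (w v u)) else (\<Sum>u\<in>A. real (w v u)))"
proof -
  have "lap (\<lambda>u. if u \<in> A then 0 else 1) v =
    (\<Sum>u\<in>A. real (w v u) * ((if v \<in> A then 0 else 1) - (if u \<in> A then 0 else 1))) +
    (\<Sum>u\<in>-A. real (w v u) * ((if v \<in> A then 0 else 1) - (if u \<in> A then 0 else 1)))"
    unfolding lap_def by (subst sum.union_disjoint[symmetric]) auto
  then show ?thesis by (auto simp: sum_negf)
qed

text \<open>
  Dhar's burning algorithm for a real configuration \<open>x\<close>. Fix a vertex \<open>q\<close> and consider the integer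
  vectors \<open>z\<close> vanishing at \<open>q\<close> for which \<open>x - L z\<close> is positive away from \<open>q\<close>. Take one of maximal
  sum. Burn the vertices one at a time, where \<open>v\<close> may burn once \<open>(x - L z) v\<close> is at most the
  number of edges from \<open>v\<close> to burnt vertices. If the fire stops early, firing the unburnt
  vertices contradicts maximality. Otherwise the order of burning is the required ranking.
\<close>

lemma le_indeg_if_not_above:
  assumes not_above: "\<And>z::'v \<Rightarrow> int. \<exists>v. x v \<le> lap (\<lambda>v. of_int (z v)) v"
  shows "\<exists>(z::'v \<Rightarrow> int) r. inj r \<and> (\<forall>v. x v \<le> lap (\<lambda>v. of_int (z v)) v + indeg r v)"
proof -
  fix q :: 'v
  define Z where "Z = {z::'v \<Rightarrow> int. z q = 0 \<and> (\<forall>v. v \<noteq> q \<longrightarrow> lap (\<lambda>v. of_int (z v)) v < x v)}"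
  \<comment> \<open>Approximate by the image of an integer vector a function lying below \<open>x\<close> by
      more than the error of the approximation, except at \<open>q\<close>, where the sum is made to vanish.\<close>
  have "Z \<noteq> {}"
  proof -
    define y where "y v = (if v = q then - (\<Sum>u\<in>UNIV - {q}. x u - deg u - 1) else x v - deg v - 1)" for v
    have "(\<Sum>v\<in>UNIV. y v) = y q + (\<Sum>v\<in>UNIV - {q}. y v)"
      by (rule sum.remove) auto
    also have "(\<Sum>v\<in>UNIV - {q}. y v) = (\<Sum>u\<in>UNIV - {q}. x u - deg u - 1)"
      by (rule sum.cong) (auto simp: y_def)
    finally have "(\<Sum>v\<in>UNIV. y v) = 0" by (simp add: y_def)
    then obtain z :: "'v \<Rightarrow> int" where z: "\<And>v. \<bar>y v - lap (\<lambda>v. of_int (z v)) v\<bar> \<le> deg v"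
      using lap_approx by blast
    have "lap (\<lambda>v. of_int (z v - z q)) v < x v" if "v \<noteq> q" for v
    proof -
      have "lap (\<lambda>v. of_int (z v - z q)) v = lap (\<lambda>v. of_int (z v)) v"
        by (simp add: lap_def)
      with z[of v] that show ?thesis by (simp add: y_def abs_le_iff)
    qed
    then have "(\<lambda>v. z v - z q) \<in> Z" by (simp add: Z_def)
    then show ?thesis by blast
  qed
  obtain B where B: "\<And>z v. z \<in> Z \<Longrightarrow> real_of_int (z v) \<le> B v"
  proof -
    have "\<exists>B. \<forall>z\<in>Z. real_of_int (z v) \<le> B" for v
    proof -
      obtain B where "\<And>z. z q = 0 \<Longrightarrow> (\<And>u. u \<noteq> q \<Longrightarrow> lap z u \<le> x u) \<Longrightarrow> z v \<le> B"
        using subsolution_bounded[of q x v] by blast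
      from this[of "\<lambda>v. of_int (z v)" for z] show ?thesis
        by (intro exI[of _ B]) (auto simp: Z_def less_imp_le)
    qed
    then show ?thesis using that by metis
  qed
  define bound where "bound = \<lceil>\<Sum>v\<in>UNIV. B v\<rceil>"
  have bound: "(\<Sum>v\<in>UNIV. z v) \<le> bound" if "z \<in> Z" for z
  proof -
    have "real_of_int (\<Sum>v\<in>UNIV. z v) \<le> (\<Sum>v\<in>UNIV. B v)"
      unfolding of_int_sum using B[OF that] by (intro sum_mono)
    then show ?thesis unfolding bound_def by linarith
  qed
  \<comment> \<open>An element of \<open>Z\<close> with maximal sum.\<close>
  define z where "z = arg_min (\<lambda>z. nat (bound - (\<Sum>v\<in>UNIV. z v))) (\<lambda>z. z \<in> Z)"
  have zZ: "z \<in> Z"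
    unfolding z_def using \<open>Z \<noteq> {}\<close> by (metis arg_min_natI equals0I)
  have z_max: "(\<Sum>v\<in>UNIV. z' v) \<le> (\<Sum>v\<in>UNIV. z v)" if "z' \<in> Z" for z'
  proof -
    have "nat (bound - (\<Sum>v\<in>UNIV. z v)) \<le> nat (bound - (\<Sum>v\<in>UNIV. z' v))"
      unfolding z_def
      using arg_min_nat_le[of "\<lambda>z. z \<in> Z" z' "\<lambda>z. nat (bound - (\<Sum>v\<in>UNIV. z v))"] that by simp
    with bound[OF that] bound[OF zZ] show ?thesis by linarith
  qed
  define x' where "x' v = x v - lap (\<lambda>v. of_int (z v)) v" for v
  \<comment> \<open>The sets of vertices that the fire can burn, with the order in which they burn.\<close>
  define good where "good A \<longleftrightarrow> (\<exists>r::'v \<Rightarrow> nat. inj_on r A \<and> r ` A \<subseteq> {..<card A} \<and>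
      (\<forall>v\<in>A. x' v \<le> (\<Sum>u | u \<in> A \<and> r u < r v. real (w v u))))" for A
  have "good {}" by (simp add: good_def)
  then obtain A where A: "good A" and A_max: "\<And>A'. good A' \<Longrightarrow> card A' \<le> card A"
    using ex_has_greatest_nat[of good "{}" card "Suc CARD('v)"]
    by (auto simp: less_Suc_eq_le card_mono)
  obtain r where r: "inj_on r A" "r ` A \<subseteq> {..<card A}"
    "\<And>v. v \<in> A \<Longrightarrow> x' v \<le> (\<Sum>u | u \<in> A \<and> r u < r v. real (w v u))"
    using A unfolding good_def by blast
  have "A = UNIV"
  proof (rule ccontr)
    assume "A \<noteq> UNIV"
    have stuck: "(\<Sum>u\<in>A. real (w v u)) < x' v" if v: "v \<notin> A" for v
    proof (rule ccontr)
      assume le: "\<not> (\<Sum>u\<in>A. real (w v u)) < x' v"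
      define r' where "r' = r(v := card A)"
      have r'A: "r' u = r u" "r u < card A" if "u \<in> A" for u
        using that v r(2) by (auto simp: r'_def)
      have "inj_on r' (insert v A)"
      proof -
        have "inj_on r' A" using r(1) r'A by (simp add: inj_on_def)
        moreover have "r' v \<notin> r' ` A" using r'A by (force simp: r'_def)
        ultimately show ?thesis using v by (simp add: inj_on_insert)
      qed
      moreover have "r' ` insert v A \<subseteq> {..<card (insert v A)}"
        using r(2) v by (auto simp: r'_def less_Suc_eq)
      moreover have "x' a \<le> (\<Sum>u | u \<in> insert v A \<and> r' u < r' a. real (w a u))"
        if "a \<in> insert v A" for a
      proof (cases "a = v")
        case True
        have "{u. u \<in> insert v A \<and> r' u < r' v} = A"
          using r'A v by (auto simp: r'_def)
        with le True show ?thesis by simp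
      next
        case False
        then have "a \<in> A" using that by simp
        then have "{u. u \<in> insert v A \<and> r' u < r' a} = {u. u \<in> A \<and> r u < r a}"
          using r'A(1) r'A(2)[OF \<open>a \<in> A\<close>] v by (auto simp: r'_def)
        with r(3) \<open>a \<in> A\<close> show ?thesis by simp
      qed
      ultimately have "good (insert v A)" unfolding good_def by blast
      from A_max[OF this] v show False by simp
    qed
    have pos: "0 < x' v" if "v \<notin> A" for v
      using stuck[OF that] sum_nonneg[of A "\<lambda>u. real (w v u)"] by simp
    have "q \<in> A"
    proof (rule ccontr)
      assume "q \<notin> A"
      have "0 < x' v" for v
        using \<open>q \<notin> A\<close> pos zZ by (cases "v = q") (auto simp: Z_def x'_def)
      moreover obtain v where "x' v \<le> 0" using not_above[of z] by (auto simp: x'_def)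
      ultimately show False using leD by blast
    qed
    \<comment> \<open>Fire all unburnt vertices once.\<close>
    define z' where "z' v = z v + (if v \<in> A then 0 else 1)" for v
    have lap': "lap (\<lambda>v. of_int (z' v)) v =
        lap (\<lambda>v. of_int (z v)) v + lap (\<lambda>u. if u \<in> A then 0 else 1) v" for v
      by (subst lap_add[symmetric], rule arg_cong2[where f = lap]) (auto simp: z'_def)
    have "lap (\<lambda>v. of_int (z' v)) v < x v" if "v \<noteq> q" for v
    proof (cases "v \<in> A")
      case True
      have "lap (\<lambda>v. of_int (z v)) v < x v" using zZ that by (simp add: Z_def)
      moreover have "0 \<le> (\<Sum>u\<in>-A. real (w v u))" by (simp add: sum_nonneg)
      ultimately show ?thesis using True by (simp add: lap' lap_indicator)
    next
      case False
      with stuck[OF False] show ?thesis by (simp add: lap' lap_indicator x'_def)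
    qed
    then have "z' \<in> Z" using zZ \<open>q \<in> A\<close> by (simp add: Z_def z'_def)
    from z_max[OF this] have "(\<Sum>v\<in>UNIV. if v \<in> A then 0 else (1::int)) \<le> 0"
      by (simp add: z'_def sum.distrib)
    then have "int (card (-A)) \<le> 0" by (simp add: sum.If_cases)
    with \<open>A \<noteq> UNIV\<close> show False by auto
  qed
  with r have "inj r" "\<And>v. x v \<le> lap (\<lambda>v. of_int (z v)) v + indeg r v"
    by (auto simp: x'_def indeg_def algebra_simps)
  then show ?thesis by blast
qed

text \<open>
  The inequality holds at the vertex of smallest rank among those at which \<open>z\<close> is maximal:
  its in-neighbours have strictly smaller, hence by integrality by at least 1 smaller, values of \<open>z\<close>.
\<close>

lemma indeg_not_above:
  fixes z :: "'v \<Rightarrow> int"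
  shows "\<exists>v. indeg r v \<le> lap (\<lambda>v. of_int (z v)) v"
proof -
  define S where "S = {v. z v = Max (range z)}"
  have "Max (range z) \<in> range z" by (rule Max_in) auto
  then obtain v0 where "Max (range z) = z v0" by (rule rangeE)
  then have "v0 \<in> S" by (simp add: S_def)
  then obtain v where v: "v \<in> S" "\<And>u. u \<in> S \<Longrightarrow> r v \<le> r u"
    using ex_has_least_nat[of "\<lambda>v. v \<in> S" v0 r] by blast
  have le: "z u \<le> z v" for u using v by (simp add: S_def)
  have lt: "z u + 1 \<le> z v" if "r u < r v" for u
  proof -
    have "u \<notin> S" using v(2)[of u] that by auto
    then have "z u \<noteq> z v" using v(1) by (simp add: S_def)
    with le[of u] show ?thesis by linarith
  qed
  have "indeg r v \<le> (\<Sum>u | r u < r v. real (w v u) * (real_of_int (z v) - real_of_int (z u)))"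
    unfolding indeg_def
  proof (rule sum_mono)
    fix u assume "u \<in> {u. r u < r v}"
    then have "real_of_int (z u + 1) \<le> real_of_int (z v)" using lt by (simp only: of_int_le_iff mem_Collect_eq)
    then have "1 \<le> real_of_int (z v) - real_of_int (z u)" by simp
    from mult_left_mono[OF this, of "real (w v u)"]
    show "real (w v u) \<le> real (w v u) * (real_of_int (z v) - real_of_int (z u))" by simp
  qed
  also have "\<dots> \<le> lap (\<lambda>v. of_int (z v)) v"
    unfolding lap_def using le by (intro sum_mono2) auto
  finally show ?thesis by blast
qed

lemma outdeg_not_above:
  fixes z :: "'v \<Rightarrow> int"
  shows "\<exists>v. outdeg r v \<le> lap (\<lambda>v. of_int (z v)) v"
proof -
  \<comment> \<open>Reversing the ranking exchanges indegree and outdegree.\<close>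
  define R where "R = Max (range r)"
  have "r v \<le> R" for v by (simp add: R_def)
  then have "outdeg r v = indeg (\<lambda>u. R - r u) v" for v
    unfolding outdeg_def indeg_def
    by (intro sum.cong) (auto simp: diff_less_mono2 less_le_trans)
  with indeg_not_above show ?thesis by simp
qed

section \<open>The critical points\<close>

text \<open>The Laplacian lattice.\<close>

definition lattice :: "(real ^ 'v) set" where
  "lattice = range (\<lambda>z::'v \<Rightarrow> int. \<chi> v. lap (\<lambda>v. of_int (z v)) v)"

text \<open>
  The point of \<open>hyperplane 0\<close> obtained by adding a constant to a translate by a lattice
  point of the negated indegree vector.
\<close>

definition crit_point :: "('v \<Rightarrow> int) \<Rightarrow> ('v \<Rightarrow> nat) \<Rightarrow> real ^ 'v" where
  "crit_point z r = (\<chi> v. mass / real CARD('v) - lap (\<lambda>v. of_int (z v)) v - indeg r v)"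

lemma lap_uminus: "lap (\<lambda>v. - z v) v = - lap z v"
  using lap_scale[of "-1" z v] by simp

lemma lattice_subset: "lattice \<subseteq> hyperplane 0"
  by (auto simp: lattice_def hyperplane_def sum_lap_UNIV)

lemma crit_point_in_hyperplane:
  assumes "inj r"
  shows "crit_point z r \<in> hyperplane 0"
  using assms by (simp add: crit_point_def hyperplane_def sum_subtractf sum_lap_UNIV sum_indeg)

lemma le_lattice_distI:
  assumes "p \<in> hyperplane 0" "\<And>z::'v \<Rightarrow> int. \<exists>v. a \<le> p $ v - lap (\<lambda>v. of_int (z v)) v"
  shows "a \<le> dist_to_set std_triangle lattice p"
  unfolding dist_to_set_def
proof (rule cINF_greatest)
  show "lattice \<noteq> {}" by (simp add: lattice_def)
  fix l assume l: "l \<in> lattice"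
  then obtain v where "a \<le> p $ v - l $ v" using assms(2) by (force simp: lattice_def)
  also have "\<dots> \<le> convex_dist std_triangle p l"
    using assms(1) l lattice_subset by (subst convex_dist_std_triangle) auto
  finally show "a \<le> convex_dist std_triangle p l" .
qed

lemma lattice_dist_le:
  fixes z :: "'v \<Rightarrow> int"
  assumes "p \<in> hyperplane 0"
  shows "\<exists>v. dist_to_set std_triangle lattice p \<le> p $ v - lap (\<lambda>v. of_int (z v)) v"
proof -
  define l :: "real^'v" where "l = (\<chi> v. lap (\<lambda>v. of_int (z v)) v)"
  have l: "l \<in> lattice" by (auto simp: l_def lattice_def)
  have "bdd_below (convex_dist std_triangle p ` lattice)"
    by (rule bdd_belowI2[of _ 0]) (use assms lattice_subset in \<open>auto intro: convex_dist_nonneg\<close>)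
  then have "dist_to_set std_triangle lattice p \<le> convex_dist std_triangle p l"
    unfolding dist_to_set_def using l by (rule cINF_lower)
  also have "\<dots> = (MAX v. p $ v - l $ v)"
    using assms l lattice_subset by (subst convex_dist_std_triangle) auto
  finally have "dist_to_set std_triangle lattice p \<le> (MAX v. p $ v - l $ v)" .
  moreover have "(MAX v. p $ v - l $ v) \<in> range (\<lambda>v. p $ v - l $ v)"
    by (rule Max_in) auto
  then obtain v where "(MAX v. p $ v - l $ v) = p $ v - l $ v" by (rule rangeE)
  ultimately show ?thesis by (auto simp: l_def)
qed

text \<open>
  The next two lemmas translate domination into distances: \<open>p\<close> lowered by \<open>h p\<close> in
  each coordinate lies above some \<open>- L z - indeg\<close>, and any such lower bound for
  \<open>p\<close> lowered by \<open>a\<close> yields \<open>a \<le> h p\<close>.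
\<close>

lemma ex_crit_point_below:
  assumes "p \<in> hyperplane 0"
  shows "\<exists>z r. inj r \<and> (\<forall>v. crit_point z r $ v - mass / real CARD('v)
      \<le> p $ v - dist_to_set std_triangle lattice p)"
proof -
  let ?h = "dist_to_set std_triangle lattice p"
  have "\<exists>v. ?h - p $ v \<le> lap (\<lambda>v. of_int (z v)) v" for z :: "'v \<Rightarrow> int"
    using lattice_dist_le[OF assms, of "\<lambda>v. - z v"] by (auto simp: lap_uminus algebra_simps)
  then obtain z :: "'v \<Rightarrow> int" and r where "inj r"
    "\<And>v. ?h - p $ v \<le> lap (\<lambda>v. of_int (z v)) v + indeg r v"
    using le_indeg_if_not_above[of "\<lambda>v. ?h - p $ v"] by blast
  then show ?thesis
    by (intro exI[of _ z] exI[of _ r]) (force simp: crit_point_def algebra_simps)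
qed

lemma le_lattice_dist_if_above_crit_point:
  assumes "inj r" "p \<in> hyperplane 0" "\<And>v. crit_point z r $ v - mass / real CARD('v) \<le> p $ v - a"
  shows "a \<le> dist_to_set std_triangle lattice p"
proof (rule le_lattice_distI[OF assms(2)])
  fix z' :: "'v \<Rightarrow> int"
  obtain v where "indeg r v \<le> lap (\<lambda>v. of_int (- z v - z' v)) v"
    using indeg_not_above[of r "\<lambda>v. - z v - z' v"] by blast
  then show "\<exists>v. a \<le> p $ v - lap (\<lambda>v. of_int (z' v)) v"
    using assms(3)[of v]
    by (intro exI[of _ v]) (simp add: crit_point_def lap_diff lap_uminus)
qed

lemma lattice_dist_le_mass:
  assumes p: "p \<in> hyperplane 0"
  shows "dist_to_set std_triangle lattice p \<le> mass / real CARD('v)"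
proof -
  let ?h = "dist_to_set std_triangle lattice p"
  obtain z r where r: "inj r"
    and le: "\<And>v. crit_point z r $ v - mass / real CARD('v) \<le> p $ v - ?h"
    using ex_crit_point_below[OF p] by blast
  have "(\<Sum>v\<in>UNIV. crit_point z r $ v - mass / real CARD('v)) \<le> (\<Sum>v\<in>UNIV. p $ v - ?h)"
    using le by (rule sum_mono)
  then have "real CARD('v) * ?h \<le> mass"
    using p crit_point_in_hyperplane[OF r, of z] by (simp add: sum_subtractf hyperplane_def)
  then show ?thesis by (simp add: field_simps)
qed

text \<open>
  For a local maximum \<open>c\<close> let \<open>k\<close> be the critical point supplied by \<open>ex_crit_point_below\<close>.
  On the segment from \<open>c\<close> to \<open>k\<close> the distance to the lattice grows at least linearly with slope
  \<open>m / n - h c\<close>. So local maximality forces \<open>h c = m / n\<close>, and then \<open>k\<close> is coordinatewise at most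
  \<open>c\<close> with the same sum of coordinates, that is, \<open>k = c\<close>.
\<close>

lemma Crit_eq: "Crit std_triangle lattice = {crit_point z r |z r. inj r}"
proof (intro equalityI subsetI)
  fix c assume "c \<in> {crit_point z r |z r. inj r}"
  then obtain z r where c: "c = crit_point z r" and r: "inj r" by blast
  have cH: "c \<in> hyperplane 0" using crit_point_in_hyperplane[OF r] c by simp
  have "mass / real CARD('v) \<le> dist_to_set std_triangle lattice c"
    by (rule le_lattice_dist_if_above_crit_point[OF r cH, of z]) (simp add: c)
  then show "c \<in> Crit std_triangle lattice"
    using cH lattice_dist_le_mass unfolding Crit_def
    by (auto intro!: exI[of _ 1] intro: order_trans)
next
  fix c assume "c \<in> Crit std_triangle lattice"
  then obtain e where cH: "c \<in> hyperplane 0" and e: "e > 0"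
    and max: "\<And>x. x \<in> hyperplane 0 \<Longrightarrow> dist x c < e \<Longrightarrow>
      dist_to_set std_triangle lattice x \<le> dist_to_set std_triangle lattice c"
    by (auto simp: Crit_def)
  let ?M = "mass / real CARD('v)"
  define h where "h = dist_to_set std_triangle lattice c"
  obtain z r where r: "inj r" and le: "\<And>v. crit_point z r $ v - ?M \<le> c $ v - h"
    using ex_crit_point_below[OF cH] unfolding h_def by blast
  define k where "k = crit_point z r"
  have kH: "k \<in> hyperplane 0" using crit_point_in_hyperplane[OF r] k_def by simp
  \<comment> \<open>A step towards \<open>k\<close> that is short enough to stay within distance \<open>e\<close> of \<open>c\<close>.\<close>
  define t where "t = min 1 (e / (2 * (norm (k - c) + 1)))"
  have pos: "0 < norm (k - c) + 1" by (smt (verit) norm_ge_zero)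
  have t: "0 < t" "t \<le> 1" using e pos by (auto simp: t_def)
  define x where "x = c + t *\<^sub>R (k - c)"
  have xH: "x \<in> hyperplane 0"
    using cH kH by (simp add: x_def hyperplane_def sum.distrib sum_distrib_left[symmetric] sum_subtractf)
  have "dist x c = t * norm (k - c)" using t by (simp add: x_def dist_norm)
  also have "\<dots> \<le> e / (2 * (norm (k - c) + 1)) * (norm (k - c) + 1)"
    using t e pos by (intro mult_mono) (auto simp: t_def)
  also have "\<dots> = e / 2"
  proof -
    have "e / (2 * d) * d = e / 2" if "0 < d" for d :: real using that by simp
    from this[OF pos] show ?thesis .
  qed
  also have "\<dots> < e" using e by simp
  finally have "dist x c < e" .
  from max[OF xH this] have x_le: "dist_to_set std_triangle lattice x \<le> h" by (simp add: h_def)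
  have "h + t * (?M - h) \<le> dist_to_set std_triangle lattice x"
  proof (rule le_lattice_dist_if_above_crit_point[OF r xH])
    fix v
    have "(1 - t) * (k $ v - ?M) \<le> (1 - t) * (c $ v - h)"
      using le[of v] t by (intro mult_left_mono) (auto simp: k_def)
    then show "crit_point z r $ v - ?M \<le> x $ v - (h + t * (?M - h))"
      by (simp add: x_def k_def algebra_simps diff_divide_distrib)
  qed
  with x_le have "t * (?M - h) \<le> 0" by linarith
  with t have "?M \<le> h" by (simp add: mult_le_0_iff)
  then have le': "k $ v \<le> c $ v" for v using le[of v] by (simp add: k_def)
  have "(\<Sum>v\<in>UNIV. c $ v - k $ v) = 0"
    using cH kH by (simp add: hyperplane_def sum_subtractf)
  then have "\<forall>v\<in>UNIV. c $ v - k $ v = 0"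
    using le' by (subst (asm) sum_nonneg_eq_0_iff) auto
  then have "c = k" by (simp add: vec_eq_iff)
  then show "c \<in> {crit_point z r |z r. inj r}" using r k_def by blast
qed

lemma crit_point_near:
  assumes "p \<in> hyperplane 0"
  shows "\<exists>c\<in>Crit std_triangle lattice. \<forall>v. p $ v - c $ v \<le> (\<Sum>u\<in>UNIV. deg u)"
proof -
  obtain r :: "'v \<Rightarrow> nat" where r: "inj r"
    using finite_imp_inj_to_nat_seg[of "UNIV :: 'v set"] by auto
  have "(\<Sum>v\<in>UNIV. p $ v - mass / real CARD('v) + indeg r v) = 0"
    using assms by (simp add: sum.distrib sum_subtractf sum_indeg[OF r] hyperplane_def)
  then obtain z :: "'v \<Rightarrow> int" where
    z: "\<And>v. \<bar>p $ v - mass / real CARD('v) + indeg r v - lap (\<lambda>v. of_int (z v)) v\<bar> \<le> deg v"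
    using lap_approx by blast
  have "p $ v - crit_point (\<lambda>v. - z v) r $ v \<le> (\<Sum>u\<in>UNIV. deg u)" for v
  proof -
    have "p $ v - crit_point (\<lambda>v. - z v) r $ v \<le> deg v"
      using z[of v] by (simp add: crit_point_def lap_uminus abs_le_iff)
    also have "deg v \<le> (\<Sum>u\<in>UNIV. deg u)"
      by (rule member_le_sum) (auto simp: deg_nonneg)
    finally show ?thesis .
  qed
  then show ?thesis using r unfolding Crit_eq by blast
qed

lemma Crit_subset: "Crit C T \<subseteq> hyperplane 0"
  by (auto simp: Crit_def)

section \<open>Points far from all critical points\<close>

lemma covering_radius_ge_at_origin:
  assumes "0 < l"
  shows "mass / (real CARD('v) * (real CARD('v) - 1 + l))
    \<le> covering_radius (P1 l) (Crit std_triangle lattice)"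
proof (rule covering_radius_geI[OF Crit_subset _ crit_point_near])
  show "std_triangle \<subseteq> P1 l" by (rule std_triangle_subset_P1)
  show "(0 :: real^'v) \<in> hyperplane 0" by (simp add: hyperplane_def)
  fix c x and \<mu> :: real
  assume c: "c \<in> Crit std_triangle lattice" and mu: "0 \<le> \<mu>" and x: "x \<in> P1 l" "c = 0 + \<mu> *\<^sub>R x"
  obtain z r where cz: "c = crit_point z r" using c Crit_eq by auto
  obtain v where v: "indeg r v \<le> lap (\<lambda>v. of_int (- z v)) v"
    using indeg_not_above[of r "\<lambda>v. - z v"] by blast
  have "c $ v = \<mu> * x $ v" by (subst x(2)) simp
  with v have "mass / real CARD('v) \<le> \<mu> * x $ v"
    by (simp add: cz crit_point_def lap_uminus)
  also have "\<dots> \<le> \<mu> * (real CARD('v) - 1 + l)"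
    using mu P1_bounds(1)[OF _ x(1)] assms by (intro mult_left_mono) auto
  finally have "mass / real CARD('v) \<le> \<mu> * (real CARD('v) - 1 + l)" .
  moreover have "0 < real CARD('v) - 1 + l" using assms one_le_card_real[where 'v = 'v] by linarith
  ultimately show "mass / (real CARD('v) * (real CARD('v) - 1 + l)) \<le> \<mu>"
    unfolding divide_divide_eq_left[symmetric] by (simp only: pos_divide_le_eq)
qed auto

text \<open>
  Here the far point is the projection to \<open>hyperplane 0\<close> of the negated degree vector. Subtracting it
  from a critical point turns indegrees into outdegrees.
\<close>

lemma covering_radius_ge_at_canonical:
  assumes "0 < l"
  shows "mass / (real CARD('v) * (1 + l * (real CARD('v) - 1)))
    \<le> covering_radius (P1 l) (Crit std_triangle lattice)"
proof (rule covering_radius_geI[OF Crit_subset _ crit_point_near])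
  define p :: "real^'v" where "p = (\<chi> v. 2 * mass / real CARD('v) - deg v)"
  show "std_triangle \<subseteq> P1 l" by (rule std_triangle_subset_P1)
  show "p \<in> hyperplane 0" by (simp add: hyperplane_def p_def sum_subtractf mass_def)
  fix c x and \<mu> :: real
  assume c: "c \<in> Crit std_triangle lattice" and mu: "0 \<le> \<mu>" and x: "x \<in> P1 l" "c = p + \<mu> *\<^sub>R x"
  obtain z r where cz: "c = crit_point z r" and r: "inj r" using c Crit_eq by auto
  obtain v where v: "outdeg r v \<le> lap (\<lambda>v. of_int (z v)) v"
    using outdeg_not_above by blast
  have "c $ v = p $ v + \<mu> * x $ v" by (subst x(2)) simp
  with v indeg_plus_outdeg[OF r, of v] have "mass / real CARD('v) \<le> \<mu> * - x $ v"
    by (simp add: cz crit_point_def p_def)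
  also have "\<dots> \<le> \<mu> * (1 + l * (real CARD('v) - 1))"
    using mu P1_bounds(2)[OF _ x(1)] assms by (intro mult_left_mono) auto
  finally have "mass / real CARD('v) \<le> \<mu> * (1 + l * (real CARD('v) - 1))" .
  moreover have "0 < 1 + l * (real CARD('v) - 1)"
    using assms one_le_card_real[where 'v = 'v] by (smt (verit) mult_nonneg_nonneg)
  ultimately show "mass / (real CARD('v) * (1 + l * (real CARD('v) - 1))) \<le> \<mu>"
    unfolding divide_divide_eq_left[symmetric] by (simp only: pos_divide_le_eq)
qed auto

end

section \<open>Counting edges of multigraphs\<close>

lemma vertex_degree_eq_sum_count:
  fixes E :: "'v::finite set multiset"
  assumes "loop_free_multigraph E"
  shows "vertex_degree E v = (\<Sum>u\<in>UNIV. count E {v, u})"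
  using assms
proof (induction E)
  case empty
  show ?case by (simp add: vertex_degree_def)
next
  case (add e E)
  then have "card e = 2" and IH: "vertex_degree E v = (\<Sum>u\<in>UNIV. count E {v, u})"
    by (auto simp: loop_free_multigraph_def)
  then obtain a b where e: "e = {a, b}" "a \<noteq> b" by (meson card_2_iff)
  have "(\<Sum>u\<in>UNIV. if e = {v, u} then 1 else 0) = (if v \<in> e then 1 else (0::nat))"
  proof -
    have "{u. e = {v, u}} = (if v = a then {b} else if v = b then {a} else {})"
      using e by (auto simp: doubleton_eq_iff)
    then show ?thesis using e by (simp add: sum.If_cases)
  qed
  moreover have "(\<Sum>u\<in>UNIV. count (add_mset e E) {v, u}) =
      (\<Sum>u\<in>UNIV. count E {v, u}) + (\<Sum>u\<in>UNIV. if e = {v, u} then 1 else 0)"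
    unfolding sum.distrib[symmetric] by (intro sum.cong) auto
  ultimately show ?case using IH by (simp add: vertex_degree_def)
qed

lemma sum_vertex_degree:
  fixes E :: "'v::finite set multiset"
  assumes "loop_free_multigraph E"
  shows "(\<Sum>v\<in>UNIV. vertex_degree E v) = 2 * size E"
  using assms
proof (induction E)
  case empty
  show ?case by (simp add: vertex_degree_def)
next
  case (add e E)
  then have e: "card e = 2" and IH: "(\<Sum>v\<in>UNIV. vertex_degree E v) = 2 * size E"
    by (auto simp: loop_free_multigraph_def)
  have "(\<Sum>v\<in>UNIV. vertex_degree (add_mset e E) v) =
      (\<Sum>v\<in>UNIV. vertex_degree E v + (if v \<in> e then 1 else 0))"
    by (intro sum.cong) (auto simp: vertex_degree_def)
  also have "\<dots> = 2 * size E + card e"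
    by (simp add: sum.distrib IH sum.If_cases)
  finally show ?case using e by simp
qed

section \<open>The inequality between the bounds\<close>

text \<open>
  Here \<open>n\<close>, \<open>m\<close>, \<open>k\<close> stand for the number of vertices, the number of edges and the stretch factor.
  The difference \<open>f l\<close> of the two sides is a convex quadratic in \<open>l\<close>, so it suffices
  that it is nonpositive at the end points \<open>1\<close> and \<open>g\<close>.
\<close>

lemma genus_quadratic_bound:
  fixes n m k l :: real
  assumes n: "2 \<le> n" and g: "1 \<le> m - n + 1" and k: "1 \<le> k" "n * (n - 1) \<le> k * m"
    and l: "1 \<le> l" "l \<le> m - n + 1"
  shows "(m - n + 1) * (n - 1 + l)\<^sup>2 \<le> k * l * m\<^sup>2"
proof -
  define g where "g = m - n + 1"
  define f where "f l = g * (n - 1 + l)\<^sup>2 - k * l * m\<^sup>2" for l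
  have f1: "f 1 \<le> 0"
  proof (cases "n * (n - 1) \<le> m")
    case True
    have "0 \<le> (m - n) * (m - n * (n - 1))"
      using True g by (intro mult_nonneg_nonneg) auto
    then have "g * n\<^sup>2 \<le> 1 * m\<^sup>2" by (simp add: g_def power2_eq_square algebra_simps)
    also have "\<dots> \<le> k * m\<^sup>2" using k by (intro mult_right_mono) auto
    finally show ?thesis by (simp add: f_def)
  next
    case False
    have "0 \<le> n * (n * (n - 1) - m)" using False n by (intro mult_nonneg_nonneg) auto
    then have "g * n\<^sup>2 \<le> n * (n - 1) * m" by (simp add: g_def power2_eq_square algebra_simps)
    also have "\<dots> \<le> k * m * m" using k g n by (intro mult_right_mono) auto
    finally show ?thesis by (simp add: f_def power2_eq_square)
  qed
  have "n - 1 + g = m" by (simp add: g_def)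
  then have "f g = (1 - k) * (g * m\<^sup>2)" by (simp add: f_def algebra_simps)
  also have "\<dots> \<le> 0" using k g by (intro mult_nonpos_nonneg) (auto simp: g_def)
  finally have fg: "f g \<le> 0" .
  have "f l \<le> 0"
  proof (cases "g = 1")
    case True
    then have "l = 1" using l by (simp add: g_def)
    then show ?thesis using f1 by simp
  next
    case False
    \<comment> \<open>Interpolation between the end points; the last term is due to the leading coefficient \<open>g\<close>.\<close>
    have "(g - 1) * f l = (g - l) * f 1 + (l - 1) * f g - g * (g - 1) * ((l - 1) * (g - l))"
      by (simp add: f_def power2_eq_square algebra_simps)
    also have "\<dots> \<le> 0"
    proof -
      have "(g - l) * f 1 \<le> 0" "(l - 1) * f g \<le> 0" "0 \<le> g * (g - 1) * ((l - 1) * (g - l))"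
        using f1 fg l g by (auto simp: g_def mult_nonneg_nonpos)
      then show ?thesis by linarith
    qed
    finally show ?thesis using False g by (simp add: g_def mult_le_0_iff)
  qed
  then show ?thesis by (simp add: f_def g_def)
qed

text \<open>The second case is the first one for \<open>1 / l\<close>.\<close>

lemma sqrt_genus_bound:
  fixes n m k l :: real
  assumes n: "2 \<le> n" and g: "1 \<le> m - n + 1" and k: "1 \<le> k" "n * (n - 1) \<le> k * m"
    and l: "0 < l"
  shows "1 \<le> l \<Longrightarrow> l \<le> m - n + 1 \<Longrightarrow> sqrt ((m - n + 1) / (k * l)) \<le> m / (n - 1 + l)"
    and "l \<le> 1 \<Longrightarrow> 1 / (m - n + 1) \<le> l \<Longrightarrow> sqrt ((m - n + 1) / (k * l)) \<le> m / (1 + l * (n - 1))"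
proof -
  assume *: "1 \<le> l" "l \<le> m - n + 1"
  have "(m - n + 1) / (k * l) \<le> m\<^sup>2 / (n - 1 + l)\<^sup>2"
    using genus_quadratic_bound[OF n g k *] k l n by (simp add: field_simps)
  then show "sqrt ((m - n + 1) / (k * l)) \<le> m / (n - 1 + l)"
    using n g l by (intro real_le_lsqrt) (auto simp: power_divide)
next
  assume *: "l \<le> 1" "1 / (m - n + 1) \<le> l"
  have "1 \<le> 1 / l" "1 / l \<le> m - n + 1" using * g l by (simp_all add: field_simps)
  from genus_quadratic_bound[OF n g k this]
  have "(m - n + 1) * (n - 1 + 1 / l)\<^sup>2 * l\<^sup>2 \<le> k * (1 / l) * m\<^sup>2 * l\<^sup>2"
    by (rule mult_right_mono) simp
  moreover have "(m - n + 1) * (n - 1 + 1 / l)\<^sup>2 * l\<^sup>2 = (m - n + 1) * (1 + l * (n - 1))\<^sup>2"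
    using l by (simp add: power_mult_distrib[symmetric] mult.assoc algebra_simps)
  moreover have "k * (1 / l) * m\<^sup>2 * l\<^sup>2 = k * l * m\<^sup>2"
    using l by (simp add: power2_eq_square)
  ultimately have "(m - n + 1) * (1 + l * (n - 1))\<^sup>2 \<le> k * l * m\<^sup>2" by simp
  moreover have "0 < 1 + l * (n - 1)" using l n by (simp add: add_pos_nonneg)
  ultimately have "(m - n + 1) / (k * l) \<le> m\<^sup>2 / (1 + l * (n - 1))\<^sup>2"
    using k l by (simp add: divide_le_eq le_divide_eq mult.commute)
  then show "sqrt ((m - n + 1) / (k * l)) \<le> m / (1 + l * (n - 1))"
    using n g l by (intro real_le_lsqrt) (auto simp: power_divide)
qed

section \<open>The covering radius of the critical points\<close>

theorem corollary4p11:
  fixes E :: "'v::finite set multiset" and lam :: real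
  assumes "CARD('v) \<ge> 2"
    and "loop_free_multigraph E"
    and "connected_multigraph E"
    and "genus E \<ge> 1"
    and "lam \<in> {1 / real_of_int (genus E) .. real_of_int (genus E)}"
  shows "covering_radius (P1 lam) (Crit std_triangle (laplacian_lattice E))
      \<ge> 1 / real CARD('v) * sqrt (real_of_int (genus E) / (real_of_int (stretch_factor E) * lam))"
proof -
  define n where "n = real CARD('v)"
  define m where "m = real (size E)"
  define k where "k = real_of_int (stretch_factor E)"
  interpret connected_weights "\<lambda>u v. count E {u, v}"
  proof
    fix u v :: 'v
    show "count E {u, v} = count E {v, u}" by (simp add: insert_commute)
    show "count E {v, v} = 0"
      using assms(2) by (auto simp: loop_free_multigraph_def count_eq_zero_iff)
    show "(u, v) \<in> {(x, y). 0 < count E {x, y}}\<^sup>*"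
      using assms(3) by (simp add: connected_multigraph_def)
  qed
  have deg: "deg v = real (vertex_degree E v)" for v
    by (simp add: deg_def vertex_degree_eq_sum_count[OF assms(2)])
  have mass: "mass = m"
    using sum_vertex_degree[OF assms(2)] by (simp add: mass_def deg m_def flip: of_nat_sum)
  have mult: "(laplacian E *v z) $ v = lap (($) z) v" for z v
  proof -
    have "(laplacian E *v z) $ v =
        (\<Sum>u\<in>UNIV. (if v = u then deg v * z $ v else 0) - real (count E {v, u}) * z $ u)"
      unfolding matrix_vector_mult_def laplacian_def
      using w_irrefl by (auto intro!: sum.cong simp: deg)
    also have "\<dots> = lap (($) z) v"
      by (simp add: lap_def sum_subtractf deg_def sum_distrib_left algebra_simps)
    finally show ?thesis .
  qed
  have lattice: "laplacian_lattice E = lattice"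
  proof (intro equalityI subsetI)
    fix x assume "x \<in> laplacian_lattice E"
    then obtain z where z: "\<And>v. z $ v \<in> \<int>" "x = laplacian E *v z"
      by (auto simp: laplacian_lattice_def)
    then have "($) z = (\<lambda>v. of_int \<lfloor>z $ v\<rfloor>)" by (simp add: fun_eq_iff)
    then have "x = (\<chi> v. lap (\<lambda>v. of_int \<lfloor>z $ v\<rfloor>) v)"
      using z(2) by (simp add: vec_eq_iff mult)
    then show "x \<in> lattice"
      unfolding lattice_def by (intro range_eqI[of _ _ "\<lambda>v. \<lfloor>z $ v\<rfloor>"]) simp
  next
    fix x assume "x \<in> lattice"
    then obtain z :: "'v \<Rightarrow> int" where "x = (\<chi> v. lap (\<lambda>v. of_int (z v)) v)"
      by (auto simp: lattice_def)
    moreover have "($) (\<chi> v. real_of_int (z v)) = (\<lambda>v. of_int (z v))"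
      by (simp add: fun_eq_iff)
    ultimately have "x = laplacian E *v (\<chi> v. of_int (z v))"
      by (simp add: vec_eq_iff mult)
    then show "x \<in> laplacian_lattice E" by (auto simp: laplacian_lattice_def)
  qed
  have g: "real_of_int (genus E) = m - n + 1" by (simp add: genus_def m_def n_def)
  have n2: "2 \<le> n" using assms(1) by (simp add: n_def)
  have g1: "1 \<le> m - n + 1" using assms(4) g by linarith
  have k1: "1 \<le> k" by (simp add: k_def stretch_factor_def)
  have "n * (n - 1) / m \<le> of_int \<lceil>n * (n - 1) / m\<rceil>" by (rule le_of_int_ceiling)
  also have "\<dots> \<le> k"
    unfolding k_def of_int_le_iff stretch_factor_def n_def m_def by (rule max.cobounded1)
  finally have k2: "n * (n - 1) \<le> k * m"
    using g1 n2 by (simp add: pos_divide_le_eq)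
  have l: "1 / (m - n + 1) \<le> lam" "lam \<le> m - n + 1" using assms(5) g by auto
  have l0: "0 < lam" using l(1) g1 by (smt (verit) zero_less_divide_1_iff)
  have "1 / n * sqrt ((m - n + 1) / (k * lam)) \<le> covering_radius (P1 lam) (Crit std_triangle lattice)"
  proof (cases "1 \<le> lam")
    case True
    have "1 / n * sqrt ((m - n + 1) / (k * lam)) \<le> 1 / n * (m / (n - 1 + lam))"
      using sqrt_genus_bound(1)[OF n2 g1 k1 k2 l0 True l(2)] n2 by (intro mult_left_mono) auto
    with covering_radius_ge_at_origin[OF l0] show ?thesis by (simp add: mass n_def)
  next
    case False
    have "1 / n * sqrt ((m - n + 1) / (k * lam)) \<le> 1 / n * (m / (1 + lam * (n - 1)))"
      using sqrt_genus_bound(2)[OF n2 g1 k1 k2 l0 _ l(1)] False n2 by (intro mult_left_mono) auto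
    with covering_radius_ge_at_canonical[OF l0] show ?thesis by (simp add: mass n_def)
  qed
  then show ?thesis by (simp add: lattice g n_def k_def)
qed

end
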